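(* Consider $K$ devices with effective channel coefficients $A_k$, a scaling factor $\eta$, local learning rates $\mu_k$ and a global learning rate $\mu$. Denote the dynamic learning rate (DLR) ratio of device $k$ by $r_k=\frac{\mu_k}{\mu}$. To mitigate the distortion $e^{ch}$ caused by the fading-channel-related term $\sqrt{\eta}A_k$, we have $$\sqrt{\eta}\sum_{k=1}^{K}A_k=1,\qquad r_k=\frac{1}{K\sqrt{\eta}\,A_k}.$$
   Context: Federated learning with over-the-air computation and $K$ devices. All quantities below are scalar components of the corresponding vectors. Given the current global model $w^{i}$, device $k$ computes the gradient $g_k$ of its local loss at $w^i$ and forms the local model $s_k=w^{i}-\mu_k g_k$, where $\mu_k$ is its local learning rate. The desired aggregate, with global learning rate $\mu$, is $y_{\mathrm{des}}=w^{i}-\frac{\mu}{K}\sum_{k=1}^K g_k$. The received signal after post-processing is $y=\sqrt{\eta}\left(\sum_{k=1}^K A_k s_k+B\right)$, where $\eta$ is a scaling factor, $A_k$ is the coefficient determined by the fading channel and beamforming of device $k$, and $B$ is the noise-related term. The distortion (aggregate error) caused by the fading channels is $e^{ch}=y_{\mathrm{des}}-\sqrt{\eta}\sum_{k=1}^K A_k s_k$. Mitigating this distortion is meant in the sense of eliminating $e^{ch}$, so that the only residual aggregate error is the noise-related term $\sqrt{\eta}B$. The condition on $r_k$ is for each device $k$. *)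

theory Defs
  imports Complex_Main
begin

text \<open>
  Devices are numbered \<open>1, \<dots>, K\<close>. Model parameters, gradients, learning rates and the scaling
  factor are real; the coefficients \<open>A k\<close> (fading channel and beamforming) and the noise term
  \<open>B\<close> are complex, which includes the case where they are real.
\<close>

definition local_model :: "(nat \<Rightarrow> real) \<Rightarrow> real \<Rightarrow> (nat \<Rightarrow> real) \<Rightarrow> nat \<Rightarrow> real" where
  "local_model \<mu>loc w g k = w - \<mu>loc k * g k"

definition desired_aggregate :: "nat \<Rightarrow> real \<Rightarrow> real \<Rightarrow> (nat \<Rightarrow> real) \<Rightarrow> real" where
  "desired_aggregate K \<mu> w g = w - \<mu> / real K * (\<Sum>k=1..K. g k)"

definition received_signal ::
  "nat \<Rightarrow> real \<Rightarrow> (nat \<Rightarrow> complex) \<Rightarrow> complex \<Rightarrow> (nat \<Rightarrow> real) \<Rightarrow> real \<Rightarrow> (nat \<Rightarrow> real) \<Rightarrow> complex" where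
  "received_signal K \<eta> A B \<mu>loc w g =
     of_real (sqrt \<eta>) * ((\<Sum>k=1..K. A k * of_real (local_model \<mu>loc w g k)) + B)"

definition channel_distortion ::
  "nat \<Rightarrow> real \<Rightarrow> (nat \<Rightarrow> complex) \<Rightarrow> (nat \<Rightarrow> real) \<Rightarrow> real \<Rightarrow> real \<Rightarrow> (nat \<Rightarrow> real) \<Rightarrow> complex" where
  "channel_distortion K \<eta> A \<mu>loc \<mu> w g =
     of_real (desired_aggregate K \<mu> w g)
     - of_real (sqrt \<eta>) * (\<Sum>k=1..K. A k * of_real (local_model \<mu>loc w g k))"

lemma aggregate_error_eq:
  "of_real (desired_aggregate K \<mu> w g) - received_signal K \<eta> A B \<mu>loc w g =
     channel_distortion K \<eta> A \<mu>loc \<mu> w g - of_real (sqrt \<eta>) * B"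
  by (simp add: received_signal_def channel_distortion_def algebra_simps)

text \<open>
  The scaling factor and the learning rates are chosen independently of the values of the current
  model and of the gradients, so the distortion has to vanish for all of these values; for a single
  \<open>(w, g)\<close> it could also vanish by accidental cancellation.
\<close>

definition distortion_eliminated ::
  "nat \<Rightarrow> real \<Rightarrow> (nat \<Rightarrow> complex) \<Rightarrow> (nat \<Rightarrow> real) \<Rightarrow> real \<Rightarrow> bool" where
  "distortion_eliminated K \<eta> A \<mu>loc \<mu> \<longleftrightarrow>
     (\<forall>w g. channel_distortion K \<eta> A \<mu>loc \<mu> w g = 0)"

definition dlr_ratio :: "(nat \<Rightarrow> real) \<Rightarrow> real \<Rightarrow> nat \<Rightarrow> real" where
  "dlr_ratio \<mu>loc \<mu> k = \<mu>loc k / \<mu>"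

end

theory Submission
  imports Defs
begin

text \<open>Vanishing for all \<open>w\<close> and \<open>g\<close> allows comparison of
  coefficients: that of \<open>w\<close> yields the sum condition, that of \<open>g k\<close> the
  equation \<surd>\<eta> A_k \<mu>_k = \<mu>/K
  (\<open>distortion_eliminated_iff_coefficients\<close>). As \<mu>/K is nonzero, the latter forces
  A_k to be nonzero and can be solved for \<mu>_k/\<mu>.\<close>

text \<open>
  The distortion is an affine function of \<open>w\<close> and the \<open>g k\<close> without constant term, so it vanishes
  identically exactly when all its coefficients do.
\<close>

lemma channel_distortion_expand:
  "channel_distortion K \<eta> A \<mu>loc \<mu> w g =
     of_real w * (1 - of_real (sqrt \<eta>) * (\<Sum>k=1..K. A k)) +
     (\<Sum>k=1..K. of_real (g k) *
        (of_real (sqrt \<eta>) * A k * of_real (\<mu>loc k) - of_real (\<mu> / real K)))"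
  unfolding channel_distortion_def desired_aggregate_def local_model_def
  by (simp add: algebra_simps sum_subtractf sum_distrib_left)

lemma distortion_eliminated_iff_coefficients:
  "distortion_eliminated K \<eta> A \<mu>loc \<mu> \<longleftrightarrow>
     of_real (sqrt \<eta>) * (\<Sum>k=1..K. A k) = 1 \<and>
     (\<forall>k\<in>{1..K}. of_real (sqrt \<eta>) * A k * of_real (\<mu>loc k) = of_real (\<mu> / real K))"
  (is "?L \<longleftrightarrow> ?S \<and> ?C")
proof
  assume ?L
  then have zero: "channel_distortion K \<eta> A \<mu>loc \<mu> w g = 0" for w g
    by (simp add: distortion_eliminated_def)
  have ?S
    using zero[of 1 "\<lambda>_. 0"] by (simp add: channel_distortion_expand)
  moreover have ?C
  proof
    fix k assume k: "k \<in> {1..K}"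
    \<comment> \<open>Evaluating at \<open>w = 0\<close> with the k-th unit vector as gradients
      isolates the coefficient of \<open>g k\<close>.\<close>
    have "(\<Sum>j=1..K. of_real (if j = k then 1 else 0) *
        (of_real (sqrt \<eta>) * A j * of_real (\<mu>loc j) - of_real (\<mu> / real K))) =
        (\<Sum>j=1..K. if j = k then
          of_real (sqrt \<eta>) * A j * of_real (\<mu>loc j) - of_real (\<mu> / real K) else 0)"
      by (rule sum.cong) auto
    also have "\<dots> = of_real (sqrt \<eta>) * A k * of_real (\<mu>loc k) - of_real (\<mu> / real K)"
      using k by simp
    finally show "of_real (sqrt \<eta>) * A k * of_real (\<mu>loc k) = of_real (\<mu> / real K)"
      using zero[of 0 "\<lambda>j. if j = k then 1 else 0"]
      unfolding channel_distortion_expand by simp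
  qed
  ultimately show "?S \<and> ?C" ..
next
  assume "?S \<and> ?C"
  then show ?L
    by (simp add: distortion_eliminated_def channel_distortion_expand)
qed

text \<open>The conjunct \<open>A k \<noteq> 0\<close> guards against \<open>1 / 0 = 0\<close>: with
  \<open>A k = 0\<close> and \<open>\<mu>loc k = 0\<close> the ratio formula would hold, although
  the distortion keeps the term -(\<mu>/K) g_k.\<close>

theorem theorem1:
  fixes K :: nat and \<eta> \<mu> :: real and A :: "nat \<Rightarrow> complex" and \<mu>loc :: "nat \<Rightarrow> real"
  assumes "K \<ge> 1" and "\<eta> \<ge> 0" and "\<mu> \<noteq> 0"
  shows "distortion_eliminated K \<eta> A \<mu>loc \<mu> \<longleftrightarrow>
    of_real (sqrt \<eta>) * (\<Sum>k=1..K. A k) = 1 \<and>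
    (\<forall>k\<in>{1..K}. A k \<noteq> 0 \<and>
       of_real (dlr_ratio \<mu>loc \<mu> k) = 1 / (of_nat K * of_real (sqrt \<eta>) * A k))"
proof -
  have "of_real (sqrt \<eta>) * A k * of_real (\<mu>loc k) = of_real (\<mu> / real K) \<longleftrightarrow>
      A k \<noteq> 0 \<and> of_real (dlr_ratio \<mu>loc \<mu> k) = 1 / (of_nat K * of_real (sqrt \<eta>) * A k)"
    if "of_real (sqrt \<eta>) * (\<Sum>k=1..K. A k) = 1" for k
  proof -
    define s :: complex where "s = of_real (sqrt \<eta>)"
    \<comment> \<open>The sum condition excludes \<surd>\<eta> = 0, which is why the equivalence for
      each device is proved under it.\<close>
    have "s \<noteq> 0" using that by (auto simp: s_def)
    moreover have "(of_nat K :: complex) \<noteq> 0" "(of_real \<mu> :: complex) \<noteq> 0"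
      using assms by auto
    ultimately show ?thesis
      unfolding dlr_ratio_def s_def[symmetric]
      by (cases "A k = 0") (auto simp: field_simps)
  qed
  then show ?thesis
    unfolding distortion_eliminated_iff_coefficients by blast
qed

end
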